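(* Let $q,k\in\mathbb{C}$ with $0<|q|<1$ and $|k|<1$. Then \[ q \sum_{n=0}^{\infty} \frac{q^{\,n-2k+k^2}\left(2 q^k-q^{n+1}-q^{2n+2}\right)}{1+q^{n+1}}\, \frac{(q;q)_n^4}{(q;q)_{k-1}^2\, (q;q)_{2n+1}\, (q;q)_{n-k+1}^2} \;=\; \frac{1}{(q;q)_{\infty }^4} \sum_{n=0}^{\infty} q^{(k+n)^2} \left((q;q)_{\infty }^3-\left(q^{1-n-k};q\right)_{\infty }^2\right) \left(q^{1+n+k};q\right)_{\infty }^2 . \]
   Context: For $|q|<1$ and $a\in\mathbb{C}$, $(a;q)_n=\prod_{j=0}^{n-1}(1-aq^j)$ for integers $n\ge 0$ (with $(a;q)_0=1$), and $(a;q)_\infty=\prod_{j=0}^{\infty}(1-aq^j)$. For non-integer (complex) $x$, $(q;q)_x$ is defined by $(q;q)_x=(q;q)_\infty/(q^{x+1};q)_\infty$ (consistent with the integer case), so that $1/(q;q)_x=(q^{x+1};q)_\infty/(q;q)_\infty$. Complex powers of $q$ are defined by $q^{a}=e^{a\log q}$ for a fixed choice of $\log q$, used consistently throughout. *)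

theory Defs
  imports "HOL-Analysis.Analysis"
begin

definition qpoch_inf :: "complex \<Rightarrow> complex \<Rightarrow> complex" where
  "qpoch_inf a q = (\<Prod>j. 1 - a * q ^ j)"

definition qpoch :: "complex \<Rightarrow> complex \<Rightarrow> nat \<Rightarrow> complex" where
  "qpoch a q n = (\<Prod>j<n. 1 - a * q ^ j)"

text \<open>Complex power q^a = exp(a * L), where L is a fixed logarithm of q (exp L = q).\<close>
definition qpow :: "complex \<Rightarrow> complex \<Rightarrow> complex" where
  "qpow L a = exp (a * L)"

text \<open>1/(q;q)_x = (q^(x+1);q)_\<infinity> / (q;q)_\<infinity> for complex x, with q = exp L.\<close>
definition qfact_inv :: "complex \<Rightarrow> complex \<Rightarrow> complex" where
  "qfact_inv L x = qpoch_inf (qpow L (x + 1)) (exp L) / qpoch_inf (exp L) (exp L)"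

end

theory Submission
  imports Defs
begin

text \<open>
  The identity is an instance of the WZ method. Write \<open>F(k, n)\<close> for the summand on the left and
  \<open>G(k + n)\<close> for the one on the right, put \<open>E = (q; q)\<^sub>\<infinity>\<close>, and let
  \<open>H(k, n) = q^(k^2) (q^(1+k); q)\<^sub>\<infinity>^2 (q^(n+1-k); q)\<^sub>\<infinity>^2 (q; q)\<^sub>n^4 / (q; q)\<^sub>2\<^sub>n\<close>. Then
  \<open>E^4 q (F(k, n) - F(k + 1, n)) = H(k, n + 1) - H(k, n)\<close>, and the limit of \<open>H(k, n)\<close> as \<open>n\<close> tends to
  infinity minus \<open>H(k, 0)\<close> is exactly \<open>G(k)\<close>. Summing over \<open>n\<close> shows that \<open>G(k)\<close> is the difference
  \<open>T(k) - T(k + 1)\<close> with \<open>T(k) = E^4 q (\<Sum>n. F(k, n))\<close>. Since \<open>T(k + N)\<close> is \<open>O(|q|^N)\<close>, the sum of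
  the \<open>G(k + n)\<close> telescopes to \<open>T(k)\<close>.
\<close>

section \<open>Convergence and recurrences of infinite q-products\<close>

text \<open>The factors differ from 1 by a geometric sequence, so the product converges absolutely.
  The type is general so that both the complex products and their real majorants are
  covered.\<close>

lemma qprod_LIMSEQ:
  fixes a q :: "'a :: {real_normed_field, banach}"
  assumes "norm q < 1"
  shows "(\<lambda>n. \<Prod>j<n. 1 - a * q ^ j) \<longlonglongrightarrow> (\<Prod>j. 1 - a * q ^ j)"
proof -
  have "summable (\<lambda>j. norm (- a * q ^ j))"
    using assms by (auto simp: norm_mult norm_power intro!: summable_mult summable_geometric)
  hence "abs_convergent_prod (\<lambda>j. 1 - a * q ^ j)"
    by (simp add: abs_convergent_prod_conv_summable)
  hence "convergent_prod (\<lambda>j. 1 - a * q ^ j)"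
    by (rule abs_convergent_prod_imp_convergent_prod)
  hence "(\<lambda>n. \<Prod>j\<le>n. 1 - a * q ^ j) \<longlonglongrightarrow> (\<Prod>j. 1 - a * q ^ j)"
    by (rule convergent_prod_LIMSEQ)
  \<comment> \<open>The library limit takes the product up to and including \<open>n\<close>; this
    index shift leads to the half-open range used in \<open>qpoch\<close>.\<close>
  hence "(\<lambda>n. \<Prod>j<Suc n. 1 - a * q ^ j) \<longlonglongrightarrow> (\<Prod>j. 1 - a * q ^ j)"
    by (simp only: lessThan_Suc_atMost)
  thus ?thesis
    by (rule LIMSEQ_imp_Suc)
qed

lemma qprod_rec:
  fixes a q :: "'a :: {real_normed_field, banach}"
  assumes "norm q < 1"
  shows "(\<Prod>j. 1 - a * q ^ j) = (1 - a) * (\<Prod>j. 1 - (a * q) * q ^ j)"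
proof -
  have "(\<lambda>n. (1 - a) * (\<Prod>j<n. 1 - (a * q) * q ^ j)) \<longlonglongrightarrow> (1 - a) * (\<Prod>j. 1 - (a * q) * q ^ j)"
    by (intro tendsto_intros qprod_LIMSEQ assms)
  also have "(\<lambda>n. (1 - a) * (\<Prod>j<n. 1 - (a * q) * q ^ j)) = (\<lambda>n. \<Prod>j<Suc n. 1 - a * q ^ j)"
    by (subst prod.lessThan_Suc_shift) (simp add: mult.assoc)
  finally have "(\<lambda>n. \<Prod>j<n. 1 - a * q ^ j) \<longlonglongrightarrow> (1 - a) * (\<Prod>j. 1 - (a * q) * q ^ j)"
    by (rule LIMSEQ_imp_Suc)
  thus ?thesis
    using qprod_LIMSEQ[OF assms] LIMSEQ_unique by blast
qed

lemma qpoch_LIMSEQ: "norm q < 1 \<Longrightarrow> (\<lambda>n. qpoch a q n) \<longlonglongrightarrow> qpoch_inf a q"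
  unfolding qpoch_def qpoch_inf_def by (rule qprod_LIMSEQ)

lemma qpoch_inf_rec: "norm q < 1 \<Longrightarrow> qpoch_inf a q = (1 - a) * qpoch_inf (a * q) q"
  unfolding qpoch_inf_def by (rule qprod_rec)

lemma qpoch_inf_split:
  assumes "norm q < 1"
  shows "qpoch_inf a q = qpoch a q n * qpoch_inf (a * q ^ n) q"
proof (induction n)
  case (Suc n)
  have "qpoch_inf (a * q ^ n) q = (1 - a * q ^ n) * qpoch_inf (a * q ^ Suc n) q"
    using qpoch_inf_rec[OF assms, of "a * q ^ n"] by (simp add: mult_ac)
  with Suc show ?case
    by (simp add: qpoch_def)
qed (simp add: qpoch_def)

section \<open>Norm bounds, continuity at 0 and nonvanishing\<close>

text \<open>The majorant \<open>(-r; \<rho>)\<^sub>\<infinity>\<close> of \<open>(a; q)\<^sub>\<infinity>\<close> for \<open>norm a \<le> r\<close> and \<open>norm q = \<rho>\<close>.\<close>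

definition qmaj :: "real \<Rightarrow> real \<Rightarrow> real" where
  "qmaj r \<rho> = (\<Prod>j. 1 - (- r) * \<rho> ^ j)"

lemma qmaj_LIMSEQ:
  assumes "0 \<le> \<rho>" "\<rho> < 1"
  shows "(\<lambda>n. \<Prod>j<n. 1 + r * \<rho> ^ j) \<longlonglongrightarrow> qmaj r \<rho>"
  using qprod_LIMSEQ[of \<rho> "- r"] assms by (simp add: qmaj_def)

lemma qmaj_rec:
  assumes "0 \<le> \<rho>" "\<rho> < 1"
  shows "qmaj r \<rho> = (1 + r) * qmaj (r * \<rho>) \<rho>"
  using qprod_rec[of \<rho> "- r"] assms by (simp add: qmaj_def)

lemma qmaj_ge_prod:
  assumes "0 \<le> \<rho>" "\<rho> < 1" "0 \<le> r"
  shows "(\<Prod>j<n. 1 + r * \<rho> ^ j) \<le> qmaj r \<rho>"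
proof (rule incseq_le[OF _ qmaj_LIMSEQ])
  show "incseq (\<lambda>n. \<Prod>j<n. 1 + r * \<rho> ^ j)"
  proof (rule incseq_SucI)
    fix n
    have "0 \<le> (\<Prod>j<n. 1 + r * \<rho> ^ j)" "1 \<le> 1 + r * \<rho> ^ n"
      using assms by (auto intro!: prod_nonneg add_nonneg_nonneg)
    thus "(\<Prod>j<n. 1 + r * \<rho> ^ j) \<le> (\<Prod>j<Suc n. 1 + r * \<rho> ^ j)"
      by (simp add: mult_le_cancel_left1)
  qed
qed (use assms in auto)

lemma qmaj_nonneg: "0 \<le> \<rho> \<Longrightarrow> \<rho> < 1 \<Longrightarrow> 0 \<le> r \<Longrightarrow> 0 \<le> qmaj r \<rho>"
  using qmaj_ge_prod[of \<rho> r 0] by simp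

text \<open>Triangle inequality in each factor. The bound is uniform in \<open>n\<close> and in all
  \<open>a\<close> with norm at most \<open>r\<close>, as the later domination of whole series
  requires.\<close>

lemma norm_qpoch_le:
  assumes "norm q < 1" "norm a \<le> r"
  shows "norm (qpoch a q n) \<le> qmaj r (norm q)"
proof -
  have r: "0 \<le> r"
    using assms norm_ge_zero order_trans by blast
  have "norm (1 - a * q ^ j) \<le> 1 + r * norm q ^ j" for j
  proof -
    have "norm (1 - a * q ^ j) \<le> 1 + norm a * norm q ^ j"
      using norm_triangle_ineq4[of 1 "a * q ^ j"] by (simp add: norm_mult norm_power)
    also have "\<dots> \<le> 1 + r * norm q ^ j"
      using assms by (intro add_left_mono mult_right_mono) auto
    finally show ?thesis .
  qed
  hence "norm (qpoch a q n) \<le> (\<Prod>j<n. 1 + r * norm q ^ j)"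
    unfolding qpoch_def prod_norm[symmetric] by (intro prod_mono) auto
  also have "\<dots> \<le> qmaj r (norm q)"
    using assms r by (intro qmaj_ge_prod) auto
  finally show ?thesis .
qed

lemma norm_qpoch_inf_le:
  assumes "norm q < 1" "norm a \<le> r"
  shows "norm (qpoch_inf a q) \<le> qmaj r (norm q)"
  using tendsto_norm[OF qpoch_LIMSEQ[OF assms(1)]] norm_qpoch_le[OF assms]
  by (intro Lim_bounded[of "\<lambda>n. norm (qpoch a q n)"]) auto

text \<open>Expanding a product of factors \<open>1 + z\<close> and using
  \<open>1 + t \<le> exp t\<close> reduces the partial products to a geometric sum; the bound then
  passes to the limit.\<close>

lemma norm_qpoch_inf_minus_1_le:
  assumes "norm q < 1"
  shows "norm (qpoch_inf a q - 1) \<le> exp (norm a / (1 - norm q)) - 1"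
proof -
  have "norm (qpoch a q n - 1) \<le> exp (norm a / (1 - norm q)) - 1" for n
  proof -
    have "norm (qpoch a q n - 1) \<le> (\<Prod>j<n. 1 + norm (- a * q ^ j)) - 1"
      using norm_prod_minus1_le_prod_minus1[of "\<lambda>j. - a * q ^ j" "{..<n}"] by (simp add: qpoch_def)
    also have "(\<Prod>j<n. 1 + norm (- a * q ^ j)) \<le> (\<Prod>j<n. exp (norm (- a * q ^ j)))"
      by (intro prod_mono conjI exp_ge_add_one_self) auto
    also have "\<dots> = exp (\<Sum>j<n. norm a * norm q ^ j)"
      by (simp add: exp_sum norm_mult norm_power)
    also have "(\<Sum>j<n. norm a * norm q ^ j) \<le> (\<Sum>j. norm a * norm q ^ j)"
      using assms by (intro sum_le_suminf summable_mult summable_geometric) auto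
    also have "\<dots> = norm a / (1 - norm q)"
      using assms by (simp add: suminf_mult suminf_geometric summable_geometric)
    finally show ?thesis
      by simp
  qed
  moreover have "(\<lambda>n. norm (qpoch a q n - 1)) \<longlonglongrightarrow> norm (qpoch_inf a q - 1)"
    by (intro tendsto_intros qpoch_LIMSEQ assms)
  ultimately show ?thesis
    by (intro Lim_bounded[of "\<lambda>n. norm (qpoch a q n - 1)"]) auto
qed

lemma qpoch_inf_tendsto_1:
  assumes "norm q < 1" "f \<longlonglongrightarrow> 0"
  shows "(\<lambda>n. qpoch_inf (f n) q) \<longlonglongrightarrow> 1"
proof -
  have "(\<lambda>n. exp (norm (f n) / (1 - norm q)) - 1) \<longlonglongrightarrow> exp (norm (0::complex) / (1 - norm q)) - 1"
    using assms by (intro tendsto_intros) auto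
  hence "(\<lambda>n. exp (norm (f n) / (1 - norm q)) - 1) \<longlonglongrightarrow> 0"
    by simp
  moreover have "\<forall>\<^sub>F n in sequentially.
      norm (qpoch_inf (f n) q - 1) \<le> exp (norm (f n) / (1 - norm q)) - 1"
    using norm_qpoch_inf_minus_1_le[OF assms(1)] by simp
  ultimately have "(\<lambda>n. qpoch_inf (f n) q - 1) \<longlonglongrightarrow> 0"
    by (rule Lim_null_comparison[rotated])
  thus ?thesis
    by (rule LIM_zero_cancel)
qed

lemma qpoch_self_nonzero:
  assumes "norm q < 1"
  shows "qpoch q q n \<noteq> 0"
proof -
  have "q ^ Suc j \<noteq> 1" for j
  proof
    assume "q ^ Suc j = 1"
    hence "norm q ^ Suc j = 1"
      by (metis norm_one norm_power)
    thus False
      using assms power_Suc_less_one[of "norm q" j] by (cases "q = 0") auto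
  qed
  thus ?thesis
    by (auto simp: qpoch_def)
qed

text \<open>Since every finite initial product is nonzero, a zero of the infinite product would
  force all its tails to vanish, yet the tails tend to 1.\<close>

lemma qpoch_inf_self_nonzero:
  assumes "norm q < 1"
  shows "qpoch_inf q q \<noteq> 0"
proof
  assume 0: "qpoch_inf q q = 0"
  have "qpoch_inf (q * q ^ n) q = 0" for n
    using qpoch_inf_split[OF assms, of q n] 0 qpoch_self_nonzero[OF assms, of n] by simp
  moreover have "(\<lambda>n. qpoch_inf (q * q ^ n) q) \<longlonglongrightarrow> 1"
    using assms by (intro qpoch_inf_tendsto_1 tendsto_mult_right_zero LIMSEQ_power_zero) auto
  ultimately have "(\<lambda>n. 0 :: complex) \<longlonglongrightarrow> 1"
    by simp
  thus False
    by (simp add: LIMSEQ_const_iff)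
qed

section \<open>Complex powers of q\<close>

lemma qpow_add: "qpow L (a + b) = qpow L a * qpow L b"
  by (simp add: qpow_def ring_distribs exp_add)

lemma qpow_diff: "qpow L (a - b) = qpow L a / qpow L b"
  by (simp add: qpow_def ring_distribs exp_diff)

lemma qpow_of_nat [simp]: "qpow L (of_nat n) = exp L ^ n"
  by (simp add: qpow_def exp_of_nat_mult)

lemma qpow_1 [simp]: "qpow L 1 = exp L"
  by (simp add: qpow_def)

lemma qpow_nonzero [simp]: "qpow L a \<noteq> 0"
  by (simp add: qpow_def)

lemma qpow_Suc: "qpow L (k + 1) = exp L * qpow L k"
  by (simp add: qpow_add)

lemma qpow_sq_Suc: "qpow L ((k + 1)\<^sup>2) = qpow L (k\<^sup>2) * (qpow L k)\<^sup>2 * exp L"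
  by (simp add: qpow_def power2_eq_square exp_add[symmetric] algebra_simps)

section \<open>The WZ pair and its certificate\<close>

definition wzF :: "complex \<Rightarrow> complex \<Rightarrow> nat \<Rightarrow> complex" where
  "wzF L k n = qpow L (of_nat n - 2 * k + k ^ 2)
        * (2 * qpow L k - exp L ^ (n + 1) - exp L ^ (2 * n + 2)) / (1 + exp L ^ (n + 1))
        * (qpoch (exp L) (exp L) n ^ 4 * qfact_inv L (k - 1) ^ 2 * qfact_inv L (of_nat (2 * n + 1))
           * qfact_inv L (of_nat n - k + 1) ^ 2)"

definition wzG :: "complex \<Rightarrow> complex \<Rightarrow> complex" where
  "wzG L k = qpow L (k ^ 2)
        * (qpoch_inf (exp L) (exp L) ^ 3 - qpoch_inf (qpow L (1 - k)) (exp L) ^ 2)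
        * qpoch_inf (qpow L (1 + k)) (exp L) ^ 2"

text \<open>The last product divided by the final denominator is \<open>1 / (q; q)_(2n)\<close>,
  kept as a quotient of infinite products so that \<open>qpoch_inf_rec\<close> performs the index
  shifts.\<close>

definition wzH :: "complex \<Rightarrow> complex \<Rightarrow> nat \<Rightarrow> complex" where
  "wzH L k n = qpow L (k ^ 2) * qpoch_inf (exp L * qpow L k) (exp L) ^ 2
        * qpoch_inf (exp L ^ (n + 1) / qpow L k) (exp L) ^ 2
        * qpoch (exp L) (exp L) n ^ 4 * qpoch_inf (exp L ^ (2 * n + 1)) (exp L)
        / qpoch_inf (exp L) (exp L)"

text \<open>Each reciprocal q-factorial contributes one \<open>1 / (q; q)_inf\<close>: two for index
  \<open>k - 1\<close>, one for \<open>2n + 1\<close> and two for \<open>n - k + 1\<close>, hence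
  the fifth power.\<close>

lemma wzF_alt:
  fixes L k :: complex
  defines "q \<equiv> exp L" and "x \<equiv> qpow L k"
  shows "wzF L k n = q ^ n / x ^ 2 * qpow L (k ^ 2) * (2 * x - q ^ (n + 1) - q ^ (2 * n + 2)) / (1 + q ^ (n + 1))
    * (qpoch q q n ^ 4 * qpoch_inf x q ^ 2 * qpoch_inf (q ^ (2 * n + 2)) q * qpoch_inf (q ^ (n + 2) / x) q ^ 2)
    / qpoch_inf q q ^ 5"
proof -
  have 1: "qpow L (of_nat n - 2 * k + k ^ 2) = q ^ n / x ^ 2 * qpow L (k ^ 2)"
    unfolding qpow_add qpow_diff mult_2 q_def x_def power2_eq_square by simp
  have 2: "qpow L (of_nat (2 * n + 1) + 1) = q ^ (2 * n + 2)"
    using qpow_of_nat[of L "2 * n + 2"] by (simp add: q_def add_ac)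
  have 3: "qpow L (of_nat n - k + 1 + 1) = q ^ (n + 2) / x"
    unfolding qpow_add qpow_diff q_def x_def by simp
  show ?thesis
    unfolding wzF_def qfact_inv_def 1 2 3 by (simp add: q_def x_def power_divide eval_nat_numeral)
qed

lemma one_plus_power_nonzero:
  fixes q :: complex
  assumes "norm q < 1"
  shows "1 + q ^ (n + 1) \<noteq> 0"
proof
  assume "1 + q ^ (n + 1) = 0"
  hence "norm (q ^ (n + 1)) = norm (- 1 :: complex)"
    by (metis add_eq_0_iff)
  moreover have "norm (q ^ (n + 1)) < 1"
    using power_Suc_less_one[of "norm q" n] assms
    by (cases "q = 0") (simp_all add: norm_power norm_mult)
  ultimately show False by simp
qed

text \<open>Separates the infinite products \<open>X\<close>, \<open>Y\<close>, \<open>Z\<close>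
  from the elementary factors \<open>a\<close>, \<open>b\<close>, \<open>d\<close> split off them.
  It serves both \<open>k\<close> and \<open>k + 1\<close>.\<close>

lemma wzF_regroup:
  fixes E :: "'a :: field"
  assumes "E \<noteq> 0"
  shows "E ^ 4 * q * (R / v * C * W / D * (A ^ 4 * (a * X)\<^sup>2 * (d * Z) * (b * Y)\<^sup>2) / E ^ 5)
    = C * X\<^sup>2 * Y\<^sup>2 * A ^ 4 * Z / E * (q * R / v * W / D * a\<^sup>2 * b\<^sup>2 * d)"
proof -
  have "E ^ 5 = E * E ^ 4"
    by (simp add: eval_nat_numeral)
  with assms show ?thesis
    by (simp add: power_mult_distrib ac_simps)
qed

text \<open>All four terms are the same product \<open>K\<close> times a rational function of
  \<open>q\<close>, \<open>q ^ n\<close> and \<open>qpow L k\<close>, so the WZ equation reduces to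
  elementary algebra.\<close>

lemma wz_step:
  fixes L k :: complex
  assumes "norm (exp L) < 1"
  shows "qpoch_inf (exp L) (exp L) ^ 4 * exp L * (wzF L k n - wzF L (k + 1) n)
           = wzH L k (Suc n) - wzH L k n"
proof -
  \<comment> \<open>Treating \<open>u\<close> as a variable with \<open>x * u = 1\<close> makes the
    final identity polynomial, within reach of \<open>algebra\<close>.\<close>
  define q x u where "q = exp L" and "x = qpow L k" and "u = 1 / x"
  define R where "R = q ^ n"
  define X Y Z where "X = qpoch_inf (q * x) q" and "Y = qpoch_inf (u * q ^ (n + 2)) q"
    and "Z = qpoch_inf (q ^ (2 * n + 3)) q"
  define E A C where "E = qpoch_inf q q" and "A = qpoch q q n" and "C = qpow L (k\<^sup>2)"
  have q: "norm q < 1"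
    using assms by (simp add: q_def)
  have nz: "q \<noteq> 0" "x \<noteq> 0" "E \<noteq> 0" "1 + q * R \<noteq> 0"
    using qpoch_inf_self_nonzero[OF q] one_plus_power_nonzero[OF q, of n]
    by (auto simp: q_def x_def E_def R_def)
  have u: "x * u = 1"
    using nz by (simp add: u_def)
  have e1: "qpoch_inf x q = (1 - x) * X"
    using qpoch_inf_rec[OF q, of x] by (simp add: X_def mult_ac)
  have e2: "qpoch_inf (q ^ (n + 2) / x) q = Y"
    by (simp add: Y_def u_def)
  have e3: "qpoch_inf (q ^ (n + 1) / x) q = (1 - u * q * R) * Y"
    using qpoch_inf_rec[OF q, of "q ^ (n + 1) / x"] by (simp add: Y_def u_def R_def mult_ac)
  have e4: "qpoch_inf (q ^ (2 * n + 2)) q = (1 - q ^ 2 * R ^ 2) * Z"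
    using qpoch_inf_rec[OF q, of "q ^ (2 * n + 2)"]
    by (simp add: Z_def R_def mult_ac power_add power_mult power2_eq_square power3_eq_cube power_mult_distrib)
  have e5: "qpoch_inf (q ^ (2 * n + 1)) q = (1 - q * R ^ 2) * ((1 - q ^ 2 * R ^ 2) * Z)"
    using qpoch_inf_rec[OF q, of "q ^ (2 * n + 1)"] e4
    by (simp add: Z_def R_def mult_ac power_add power_mult power2_eq_square power_mult_distrib)
  have e6: "qpoch q q (Suc n) = A * (1 - q * R)"
    by (simp add: A_def R_def qpoch_def)
  have p: "q ^ (n + 1) = q * R" "q ^ (2 * n + 2) = q\<^sup>2 * R\<^sup>2"
    by (simp_all add: R_def power_add power_mult power2_eq_square power_mult_distrib)
  define K where "K = C * X\<^sup>2 * Y\<^sup>2 * A ^ 4 * Z / E"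
  have F1: "E ^ 4 * q * wzF L k n = K * (q * R * u\<^sup>2 * (2 * x - q * R - q\<^sup>2 * R\<^sup>2) / (1 + q * R)
      * (1 - x)\<^sup>2 * (1 - q\<^sup>2 * R\<^sup>2))"
  proof -
    have "E ^ 4 * q * wzF L k n = E ^ 4 * q * (R / x\<^sup>2 * C * (2 * x - q * R - q\<^sup>2 * R\<^sup>2) / (1 + q * R)
      * (A ^ 4 * ((1 - x) * X)\<^sup>2 * ((1 - q\<^sup>2 * R\<^sup>2) * Z) * (1 * Y)\<^sup>2) / E ^ 5)"
      unfolding wzF_alt q_def[symmetric] x_def[symmetric] e1 e2 e4
      unfolding p R_def C_def A_def E_def by simp
    also have "\<dots> = K * (q * R / x\<^sup>2 * (2 * x - q * R - q\<^sup>2 * R\<^sup>2) / (1 + q * R)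
      * (1 - x)\<^sup>2 * 1\<^sup>2 * (1 - q\<^sup>2 * R\<^sup>2))"
      unfolding K_def by (rule wzF_regroup[OF nz(3)])
    finally show ?thesis
      by (simp add: u_def power_divide)
  qed
  have e7: "qpow L (k + 1) = q * x" "qpow L ((k + 1)\<^sup>2) = C * x\<^sup>2 * q"
    using qpow_Suc[of L k] qpow_sq_Suc[of L k] by (simp_all add: q_def x_def C_def)
  \<comment> \<open>Replacing \<open>k\<close> by \<open>k + 1\<close> moves the argument back to
    \<open>q ^ (n + 1) / x\<close>, so \<open>e3\<close> expresses it through the same
    \<open>Y\<close>.\<close>
  have e8: "qpoch_inf (q ^ (n + 2) / (q * x)) q = (1 - u * q * R) * Y"
    using e3 nz by (simp add: field_simps)
  have F2: "E ^ 4 * q * wzF L (k + 1) n = K * (R * (2 * q * x - q * R - q\<^sup>2 * R\<^sup>2) / (1 + q * R)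
      * (1 - u * q * R)\<^sup>2 * (1 - q\<^sup>2 * R\<^sup>2))"
  proof -
    have "E ^ 4 * q * wzF L (k + 1) n
      = E ^ 4 * q * (R / (q * x)\<^sup>2 * (C * x\<^sup>2 * q) * (2 * q * x - q * R - q\<^sup>2 * R\<^sup>2) / (1 + q * R)
      * (A ^ 4 * (1 * X)\<^sup>2 * ((1 - q\<^sup>2 * R\<^sup>2) * Z) * ((1 - u * q * R) * Y)\<^sup>2) / E ^ 5)"
      unfolding wzF_alt q_def[symmetric] e7 e8 e4
      unfolding p R_def A_def E_def X_def by (simp add: mult.assoc)
    also have "\<dots> = C * x\<^sup>2 * q * X\<^sup>2 * Y\<^sup>2 * A ^ 4 * Z / E
      * (q * R / (q * x)\<^sup>2 * (2 * q * x - q * R - q\<^sup>2 * R\<^sup>2) / (1 + q * R)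
      * 1\<^sup>2 * (1 - u * q * R)\<^sup>2 * (1 - q\<^sup>2 * R\<^sup>2))"
      by (rule wzF_regroup[OF nz(3)])
    also have "\<dots> = (x\<^sup>2 * q * q / (q * x)\<^sup>2) * (K * (R * (2 * q * x - q * R - q\<^sup>2 * R\<^sup>2) / (1 + q * R)
      * (1 - u * q * R)\<^sup>2 * (1 - q\<^sup>2 * R\<^sup>2)))"
      by (simp add: K_def mult_ac)
    \<comment> \<open>The growth of the quadratic power of \<open>q\<close> cancels against the
      linear one, which leaves the same \<open>K\<close> as for \<open>k\<close>.\<close>
    also have "x\<^sup>2 * q * q / (q * x)\<^sup>2 = 1"
      using nz by (simp add: power2_eq_square)
    finally show ?thesis
      by simp
  qed
  have H1: "wzH L k (Suc n) = K * (1 - q * R) ^ 4"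
  proof -
    have "qpoch_inf (q ^ (Suc n + 1) / x) q = Y" "qpoch_inf (q ^ (2 * Suc n + 1)) q = Z"
      by (simp_all add: Y_def Z_def u_def eval_nat_numeral)
    thus ?thesis
      unfolding wzH_def q_def[symmetric] x_def[symmetric] e6 X_def[symmetric] E_def[symmetric]
        C_def[symmetric] K_def
      by (simp only:) (simp add: power_mult_distrib mult_ac)
  qed
  have H2: "wzH L k n = K * ((1 - u * q * R)\<^sup>2 * (1 - q * R\<^sup>2) * (1 - q\<^sup>2 * R\<^sup>2))"
    unfolding wzH_def q_def[symmetric] x_def[symmetric] e3 e5 X_def[symmetric] E_def[symmetric]
        C_def[symmetric] A_def[symmetric] K_def
    by (simp add: power_mult_distrib mult_ac)
  \<comment> \<open>The factor split off from \<open>1 / (q; q)_(2n+1)\<close> clears the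
    denominator \<open>1 + q * R\<close>.\<close>
  have sq: "1 - q\<^sup>2 * R\<^sup>2 = (1 + q * R) * (1 - q * R)"
    by (simp add: algebra_simps power2_eq_square)
  have "q * R * u\<^sup>2 * (2 * x - q * R - q\<^sup>2 * R\<^sup>2) / (1 + q * R) * (1 - x)\<^sup>2 * (1 - q\<^sup>2 * R\<^sup>2)
      - R * (2 * q * x - q * R - q\<^sup>2 * R\<^sup>2) / (1 + q * R) * (1 - u * q * R)\<^sup>2 * (1 - q\<^sup>2 * R\<^sup>2)
     = q * R * u\<^sup>2 * (2 * x - q * R - q\<^sup>2 * R\<^sup>2) * (1 - x)\<^sup>2 * (1 - q * R)
      - R * (2 * q * x - q * R - q\<^sup>2 * R\<^sup>2) * (1 - u * q * R)\<^sup>2 * (1 - q * R)"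
    unfolding sq using nz by simp
  also have "\<dots> = (1 - q * R) ^ 4 - (1 - u * q * R)\<^sup>2 * (1 - q * R\<^sup>2) * (1 - q\<^sup>2 * R\<^sup>2)"
    using u by algebra
  finally have "K * (q * R * u\<^sup>2 * (2 * x - q * R - q\<^sup>2 * R\<^sup>2) / (1 + q * R) * (1 - x)\<^sup>2 * (1 - q\<^sup>2 * R\<^sup>2))
      - K * (R * (2 * q * x - q * R - q\<^sup>2 * R\<^sup>2) / (1 + q * R) * (1 - u * q * R)\<^sup>2 * (1 - q\<^sup>2 * R\<^sup>2))
     = K * (1 - q * R) ^ 4 - K * ((1 - u * q * R)\<^sup>2 * (1 - q * R\<^sup>2) * (1 - q\<^sup>2 * R\<^sup>2))"
    by (simp only: right_diff_distrib[symmetric])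
  hence "E ^ 4 * q * wzF L k n - E ^ 4 * q * wzF L (k + 1) n = wzH L k (Suc n) - wzH L k n"
    unfolding F1 F2 H1 H2 .
  thus ?thesis
    unfolding E_def q_def right_diff_distrib .
qed

lemma wzH_0: "wzH L k 0 = qpow L (k\<^sup>2) * qpoch_inf (qpow L (1 + k)) (exp L) ^ 2
    * qpoch_inf (qpow L (1 - k)) (exp L) ^ 2" if "norm (exp L) < 1"
  using qpoch_inf_self_nonzero[OF that]
  by (simp add: wzH_def qpow_add qpow_diff qpoch_def)

text \<open>The two products whose arguments tend to 0 tend to 1, and the remaining
  \<open>(q; q)_inf ^ 4 / (q; q)_inf\<close> gives the cube.\<close>

lemma wzH_tendsto:
  assumes "norm (exp L) < 1"
  shows "wzH L k \<longlonglongrightarrow> qpow L (k\<^sup>2) * qpoch_inf (qpow L (1 + k)) (exp L) ^ 2 * qpoch_inf (exp L) (exp L) ^ 3"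
proof -
  let ?E = "qpoch_inf (exp L) (exp L)"
  have E: "?E \<noteq> 0"
    using qpoch_inf_self_nonzero[OF assms] .
  have "(\<lambda>n. exp L ^ (n + 1) / qpow L k) \<longlonglongrightarrow> 0" "(\<lambda>n. exp L ^ (2 * n + 1)) \<longlonglongrightarrow> 0"
  proof -
    have 0: "(\<lambda>n. exp L ^ n) \<longlonglongrightarrow> 0"
      using assms by (rule LIMSEQ_power_zero)
    show "(\<lambda>n. exp L ^ (n + 1) / qpow L k) \<longlonglongrightarrow> 0"
      by (intro tendsto_divide_zero LIMSEQ_ignore_initial_segment 0)
    show "(\<lambda>n. exp L ^ (2 * n + 1)) \<longlonglongrightarrow> 0"
      by (rule filterlim_compose[OF 0]) (auto intro!: filterlim_subseq strict_monoI)
  qed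
  note lims = this[THEN qpoch_inf_tendsto_1[OF assms]] qpoch_LIMSEQ[OF assms]
  have "wzH L k \<longlonglongrightarrow> qpow L (k\<^sup>2) * qpoch_inf (exp L * qpow L k) (exp L) ^ 2 * 1 ^ 2 * ?E ^ 4 * 1 / ?E"
    unfolding wzH_def by (intro tendsto_intros lims E)
  thus ?thesis
    using E by (simp add: qpow_add eval_nat_numeral mult.assoc)
qed

lemma wz_sums:
  assumes "norm (exp L) < 1"
  shows "(\<lambda>n. qpoch_inf (exp L) (exp L) ^ 4 * exp L * (wzF L k n - wzF L (k + 1) n)) sums wzG L k"
proof -
  have "(\<lambda>n. wzH L k (Suc n) - wzH L k n) sums
     (qpow L (k\<^sup>2) * qpoch_inf (qpow L (1 + k)) (exp L) ^ 2 * qpoch_inf (exp L) (exp L) ^ 3 - wzH L k 0)"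
    by (intro telescope_sums wzH_tendsto assms)
  thus ?thesis
    unfolding wz_step[OF assms] wzH_0[OF assms] wzG_def by (simp add: algebra_simps)
qed

section \<open>Decay of the left-hand series under shifts of k\<close>

text \<open>
  The factors of \<open>wzF L k n\<close> that are not obviously bounded along \<open>k, k + 1, k + 2, \<dots>\<close>, with
  \<open>(q^(n+2-k); q)\<^sub>\<infinity>\<close> replaced by its majorant at \<open>n = 0\<close>.
\<close>

definition wzB :: "complex \<Rightarrow> complex \<Rightarrow> real" where
  "wzB L k = norm (qpow L (k\<^sup>2)) / norm (qpow L k) ^ 2
     * qmaj (norm (exp L) ^ 2 / norm (qpow L k)) (norm (exp L)) ^ 2"

text \<open>With \<open>r = norm (qpow L k)\<close>, the power part gains
  \<open>r^2 / \<rho>\<close> and the squared majorant gains \<open>(1 + \<rho> / r)^2\<close>. As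
  \<open>r\<close> shrinks these balance, which leaves a factor close to
  \<open>\<rho>\<close>.\<close>

lemma wzB_Suc:
  fixes L k :: complex
  defines "\<rho> \<equiv> norm (exp L)"
  assumes "\<rho> < 1"
  shows "wzB L (k + 1) = \<rho> * (1 + norm (qpow L k) / \<rho>)\<^sup>2 * wzB L k"
proof -
  define r where "r = norm (qpow L k)"
  have pos: "0 < \<rho>" "0 < r"
    by (simp_all add: \<rho>_def r_def)
  have "qmaj (\<rho>\<^sup>2 / (\<rho> * r)) \<rho> = (1 + \<rho> / r) * qmaj (\<rho>\<^sup>2 / r) \<rho>"
    using qmaj_rec[of \<rho> "\<rho> / r"] assms(2) pos by (simp add: power2_eq_square)
  hence "wzB L (k + 1) = norm (qpow L (k\<^sup>2)) * r\<^sup>2 * \<rho> / (\<rho> * r)\<^sup>2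
      * ((1 + \<rho> / r) * qmaj (\<rho>\<^sup>2 / r) \<rho>)\<^sup>2"
    unfolding wzB_def qpow_Suc qpow_sq_Suc norm_mult norm_power \<rho>_def[symmetric] r_def[symmetric] by simp
  also have "\<dots> = (r\<^sup>2 * \<rho> / (\<rho> * r)\<^sup>2 * (1 + \<rho> / r)\<^sup>2 * r\<^sup>2)
      * (norm (qpow L (k\<^sup>2)) / r\<^sup>2 * (qmaj (\<rho>\<^sup>2 / r) \<rho>)\<^sup>2)"
    using pos by (simp add: power_mult_distrib)
  also have "norm (qpow L (k\<^sup>2)) / r\<^sup>2 * (qmaj (\<rho>\<^sup>2 / r) \<rho>)\<^sup>2 = wzB L k"
    by (simp add: wzB_def r_def \<rho>_def)
  also have "r\<^sup>2 * \<rho> / (\<rho> * r)\<^sup>2 * (1 + \<rho> / r)\<^sup>2 * r\<^sup>2 = \<rho> * (1 + r / \<rho>)\<^sup>2"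
    using pos by (simp add: field_simps power2_eq_square)
  finally show ?thesis
    by (simp add: r_def)
qed

lemma wzB_add:
  fixes L k :: complex
  defines "\<rho> \<equiv> norm (exp L)"
  assumes "\<rho> < 1"
  shows "wzB L (k + of_nat N) = \<rho> ^ N * (\<Prod>j<N. 1 + norm (qpow L k) / \<rho> * \<rho> ^ j)\<^sup>2 * wzB L k"
proof (induction N)
  case (Suc N)
  have "wzB L (k + of_nat (Suc N)) = wzB L ((k + of_nat N) + 1)"
    by (simp add: add_ac)
  also have "\<dots> = \<rho> * (1 + norm (qpow L k) / \<rho> * \<rho> ^ N)\<^sup>2 * wzB L (k + of_nat N)"
    using wzB_Suc[of L "k + of_nat N"] assms by (simp add: qpow_add norm_mult norm_power)
  finally show ?case
    unfolding Suc.IH by (simp add: power_mult_distrib mult_ac)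
qed simp

text \<open>The finite products converge to a value of \<open>qmaj\<close>, so the geometric factor
  decides the limit.\<close>

lemma wzB_tendsto_0:
  assumes "norm (exp L) < 1"
  shows "(\<lambda>N. wzB L (k + of_nat N)) \<longlonglongrightarrow> 0"
proof -
  let ?\<rho> = "norm (exp L)"
  have "(\<lambda>N. ?\<rho> ^ N * (\<Prod>j<N. 1 + norm (qpow L k) / ?\<rho> * ?\<rho> ^ j)\<^sup>2 * wzB L k)
     \<longlonglongrightarrow> 0 * (qmaj (norm (qpow L k) / ?\<rho>) ?\<rho>)\<^sup>2 * wzB L k"
    using assms by (intro tendsto_intros qmaj_LIMSEQ LIMSEQ_power_zero) auto
  thus ?thesis
    by (simp add: wzB_add[OF assms])
qed

text \<open>The separate parameter \<open>x\<close> keeps the constant independent of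
  \<open>k\<close>: one \<open>x\<close> works for all shifts \<open>k + N\<close>. The fifth power
  of \<open>qmaj 1 \<rho>\<close> collects \<open>(q; q)_n ^ 4\<close> and
  \<open>(q^(2n+2); q)_inf\<close>.\<close>

lemma norm_wzF_le:
  fixes L k :: complex
  defines "\<rho> \<equiv> norm (exp L)"
  assumes \<rho>: "\<rho> < 1" and x: "norm (qpow L k) \<le> x"
  shows "norm (wzF L k n) \<le> (2 * x + 2) / (1 - \<rho>) * qmaj 1 \<rho> ^ 5 * qmaj x \<rho> ^ 2
     / norm (qpoch_inf (exp L) (exp L)) ^ 5 * wzB L k * \<rho> ^ n"
proof -
  define q y where "q = exp L" and "y = qpow L k"
  have q: "norm q = \<rho>" "norm q < 1" and y: "y \<noteq> 0" and \<rho>0: "0 < \<rho>"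
    using \<rho> by (simp_all add: q_def \<rho>_def y_def)
  have x0: "0 \<le> x"
    using x norm_ge_zero order_trans by blast
  have le1: "\<rho> ^ m \<le> 1" for m
    using \<rho> \<rho>0 by (simp add: power_le_one)
  have b1: "norm (2 * y - q ^ (n + 1) - q ^ (2 * n + 2)) \<le> 2 * x + 2"
  proof -
    have "norm (2 * y - q ^ (n + 1) - q ^ (2 * n + 2)) \<le> norm (2 * y) + norm (q ^ (n + 1)) + norm (q ^ (2 * n + 2))"
      by (meson add_right_mono norm_triangle_ineq4 order_trans)
    also have "\<dots> = 2 * norm y + \<rho> ^ (n + 1) + \<rho> ^ (2 * n + 2)"
      by (simp only: norm_mult norm_power q norm_numeral)
    also have "\<dots> \<le> 2 * x + 1 + 1"
      using x by (intro add_mono le1 mult_left_mono) (auto simp: y_def)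
    finally show ?thesis by simp
  qed
  have b2: "1 - \<rho> \<le> norm (1 + q ^ (n + 1))"
  proof -
    have "\<rho> ^ (n + 1) \<le> \<rho>"
      using le1[of n] \<rho>0 by (simp add: mult_left_le)
    hence "1 - \<rho> \<le> norm (1::complex) - norm (- (q ^ (n + 1)))"
      by (simp only: norm_power norm_minus_cancel q norm_one)
    also have "\<dots> \<le> norm (1 - - (q ^ (n + 1)))"
      by (rule norm_triangle_ineq2)
    finally show ?thesis by simp
  qed
  have b3: "norm (qpoch q q n) \<le> qmaj 1 \<rho>"
    using norm_qpoch_le[of q q 1 n] q by simp
  have b4: "norm (qpoch_inf y q) \<le> qmaj x \<rho>"
    using norm_qpoch_inf_le[of q y x] q x by (simp add: y_def)
  have b5: "norm (qpoch_inf (q ^ (2 * n + 2)) q) \<le> qmaj 1 \<rho>"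
    using norm_qpoch_inf_le[OF q(2), of "q ^ (2 * n + 2)" 1] q le1[of "2 * n + 2"] by (simp only: norm_power)
  have b6: "norm (qpoch_inf (q ^ (n + 2) / y) q) \<le> qmaj (\<rho>\<^sup>2 / norm y) \<rho>"
  proof -
    have "norm (q ^ (n + 2) / y) \<le> \<rho>\<^sup>2 / norm y"
      using le1[of n] unfolding norm_divide norm_power q power_add
      by (intro divide_right_mono) (simp_all add: norm_mult norm_power q mult_left_le_one_le \<rho>0 less_imp_le)
    thus ?thesis
      by (rule norm_qpoch_inf_le[OF q(2), unfolded q(1)])
  qed
  have "norm (wzF L k n) = \<rho> ^ n / norm y ^ 2 * norm (qpow L (k ^ 2))
      * norm (2 * y - q ^ (n + 1) - q ^ (2 * n + 2)) / norm (1 + q ^ (n + 1))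
      * (norm (qpoch q q n) ^ 4 * norm (qpoch_inf y q) ^ 2 * norm (qpoch_inf (q ^ (2 * n + 2)) q)
         * norm (qpoch_inf (q ^ (n + 2) / y) q) ^ 2) / norm (qpoch_inf q q) ^ 5"
    unfolding wzF_alt q_def[symmetric] y_def[symmetric] norm_mult norm_divide norm_power q ..
  also have "\<dots> \<le> \<rho> ^ n / norm y ^ 2 * norm (qpow L (k ^ 2)) * (2 * x + 2) / (1 - \<rho>)
      * (qmaj 1 \<rho> ^ 4 * qmaj x \<rho> ^ 2 * qmaj 1 \<rho> * qmaj (\<rho>\<^sup>2 / norm y) \<rho> ^ 2) / norm (qpoch_inf q q) ^ 5"
    using \<rho> \<rho>0 x0
    by (intro divide_right_mono mult_mono frac_le mult_left_mono power_mono b1 b2 b3 b4 b5 b6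
          mult_nonneg_nonneg divide_nonneg_nonneg qmaj_nonneg zero_le_power norm_ge_zero) auto
  also have "\<dots> = (2 * x + 2) / (1 - \<rho>) * qmaj 1 \<rho> ^ 5 * qmaj x \<rho> ^ 2
     / norm (qpoch_inf (exp L) (exp L)) ^ 5 * wzB L k * \<rho> ^ n"
    by (simp add: wzB_def q_def y_def \<rho>_def eval_nat_numeral mult_ac)
  finally show ?thesis .
qed

lemma summable_wzF:
  assumes "norm (exp L) < 1"
  shows "summable (wzF L k)"
  by (rule summable_comparison_test'[OF summable_mult[OF summable_geometric]
        norm_wzF_le[OF assms order.refl]]) (use assms in simp)

lemma suminf_wzF_tendsto_0:
  assumes "norm (exp L) < 1"
  shows "(\<lambda>N. suminf (wzF L (k + of_nat N))) \<longlonglongrightarrow> 0"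
proof -
  let ?\<rho> = "norm (exp L)"
  \<comment> \<open>Since \<open>norm (exp L) < 1\<close>, this value also bounds the norm of
    \<open>qpow L (k + of_nat N)\<close>, so \<open>c\<close> does not depend on
    \<open>N\<close>.\<close>
  define x where "x = norm (qpow L k)"
  define c where "c = (2 * x + 2) / (1 - ?\<rho>) * qmaj 1 ?\<rho> ^ 5 * qmaj x ?\<rho> ^ 2
     / norm (qpoch_inf (exp L) (exp L)) ^ 5"
  have "norm (suminf (wzF L (k + of_nat N))) \<le> c * wzB L (k + of_nat N) * (1 / (1 - ?\<rho>))" for N
  proof -
    have "norm (qpow L (k + of_nat N)) \<le> x"
      using assms by (simp add: qpow_add norm_mult norm_power x_def mult_left_le power_le_one)
    hence "norm (wzF L (k + of_nat N) n) \<le> c * wzB L (k + of_nat N) * ?\<rho> ^ n" for n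
      unfolding c_def by (intro norm_wzF_le assms)
    hence "norm (suminf (wzF L (k + of_nat N))) \<le> (\<Sum>n. c * wzB L (k + of_nat N) * ?\<rho> ^ n)"
      using assms by (intro norm_suminf_le summable_mult summable_geometric) auto
    thus ?thesis
      using assms by (simp add: suminf_mult suminf_geometric summable_geometric)
  qed
  moreover have "(\<lambda>N. c * wzB L (k + of_nat N) * (1 / (1 - ?\<rho>))) \<longlonglongrightarrow> 0"
    by (intro tendsto_mult_left_zero tendsto_mult_right_zero wzB_tendsto_0 assms)
  ultimately show ?thesis
    by (rule Lim_null_comparison[OF always_eventually[OF allI]])
qed

section \<open>Telescoping in k and the final identity\<close>

lemma wzG_sums:
  assumes "norm (exp L) < 1"
  shows "(\<lambda>j. wzG L (k + of_nat j)) sums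
    (qpoch_inf (exp L) (exp L) ^ 4 * exp L * suminf (wzF L k))"
proof -
  define T where "T N = qpoch_inf (exp L) (exp L) ^ 4 * exp L * suminf (wzF L (k + of_nat N))" for N
  have "wzG L (k + of_nat j) = T j - T (Suc j)" for j
  proof -
    have "wzG L (k + of_nat j) = (\<Sum>n. qpoch_inf (exp L) (exp L) ^ 4 * exp L
        * (wzF L (k + of_nat j) n - wzF L (k + of_nat j + 1) n))"
      using wz_sums[OF assms] by (simp add: sums_iff)
    \<comment> \<open>Splitting the sum of differences is legitimate because both series converge by
      \<open>summable_wzF\<close>.\<close>
    also have "\<dots> = T j - T (Suc j)"
      by (simp add: suminf_mult summable_diff suminf_diff[symmetric] summable_wzF[OF assms] T_def
            right_diff_distrib[symmetric] add_ac)
    finally show ?thesis .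
  qed
  moreover have "T \<longlonglongrightarrow> 0"
    unfolding T_def by (intro tendsto_mult_right_zero suminf_wzF_tendsto_0 assms)
  hence "(\<lambda>j. T j - T (Suc j)) sums (T 0 - 0)"
    by (rule telescope_sums')
  ultimately show ?thesis
    by (simp add: T_def)
qed

text \<open>Summability is asserted with the identity because \<open>suminf\<close> is meaningful
  only for convergent series. The constant \<open>L\<close> fixes the branch of the
  logarithm.\<close>

theorem theorem1:
  fixes q k L :: complex
  assumes "0 < norm q" "norm q < 1" "norm k < 1" "exp L = q"
  defines "F \<equiv> (\<lambda>n::nat.
      qpow L (of_nat n - 2 * k + k ^ 2)
        * (2 * qpow L k - q ^ (n + 1) - q ^ (2 * n + 2)) / (1 + q ^ (n + 1))
        * (qpoch q q n ^ 4 * qfact_inv L (k - 1) ^ 2 * qfact_inv L (of_nat (2 * n + 1))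
           * qfact_inv L (of_nat n - k + 1) ^ 2))"
    and "G \<equiv> (\<lambda>n::nat.
      qpow L ((k + of_nat n) ^ 2)
        * (qpoch_inf q q ^ 3 - qpoch_inf (qpow L (1 - of_nat n - k)) q ^ 2)
        * qpoch_inf (qpow L (1 + of_nat n + k)) q ^ 2)"
  shows "summable F \<and> summable G \<and>
         q * (\<Sum>n. F n) = (1 / qpoch_inf q q ^ 4) * (\<Sum>n. G n)"
proof -
  have F: "F = wzF L k"
    by (simp add: F_def wzF_def fun_eq_iff flip: assms(4))
  have G: "G = (\<lambda>j. wzG L (k + of_nat j))"
    by (simp add: G_def wzG_def fun_eq_iff algebra_simps flip: assms(4))
  have q: "norm (exp L) < 1"
    using assms(2,4) by simp
  show ?thesis
    unfolding F G using summable_wzF[OF q] wzG_sums[OF q, of k] qpoch_inf_self_nonzero[OF assms(2)] assms(4)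
    by (auto simp: sums_iff)
qed

end
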